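(* There exists a Banach space $\mathrm{Z}$ with a $1$-unconditional Schauder basis such that for every $p\in[1,\infty)$ the space $\ell^{p}$ is contained almost isometrically in $\mathrm{Z}$ (in particular $\mathrm{Z}$ contains an isomorphic copy of $\ell^p$ for every $p\in[1,\infty)$).
   Context: Banach spaces are real. A Schauder basis $(f_n)$ is $1$-unconditional if $\|\sum_n \theta_n a_n f_n\|=\|\sum_n a_n f_n\|$ for every convergent series $\sum_n a_nf_n$ and all signs $\theta_n\in\{-1,1\}$. For mutually isomorphic Banach spaces $\mathrm{X},\mathrm{Y}$ the Banach–Mazur distance is $d_{\mathrm{BM}}(\mathrm{X},\mathrm{Y})=\inf\{\|T\|\cdot\|T^{-1}\|:\ T\colon \mathrm{X}\to \mathrm{Y}\text{ is an isomorphism}\}$. A Banach space $\mathrm{X}$ is contained almost isometrically in a Banach space $\mathrm{Z}$ if for each $\epsilon>0$ there is a subspace $\mathrm{Y}\subset \mathrm{Z}$ isomorphic to $\mathrm{X}$ with $d_{\mathrm{BM}}(\mathrm{X},\mathrm{Y})<1+\epsilon$. *)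

theory Defs
  imports Complex_Main "HOL-Library.Function_Algebras"
begin

section \<open>The real vector space of functions\<close>

instantiation "fun" :: (type, real_vector) real_vector
begin

definition scaleR_fun :: "real \<Rightarrow> ('a \<Rightarrow> 'b) \<Rightarrow> 'a \<Rightarrow> 'b"
  where "scaleR_fun c f = (\<lambda>x. c *\<^sub>R f x)"

instance
  by standard (simp_all add: scaleR_fun_def fun_eq_iff scaleR_add_right scaleR_add_left)

end

section \<open>Banach spaces with a carrier\<close>

text \<open>
  A normed space is a pair \<open>(X, N)\<close>: a linear subspace \<open>X\<close> of some type of class
  \<^class>\<open>real_vector\<close>, which only supplies the vector space operations, and a function \<open>N\<close> that is
  a norm on \<open>X\<close>; the values of \<open>N\<close> outside \<open>X\<close> are irrelevant. Any topology or norm that the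
  ambient type may carry plays no role. Via its coefficient sequences, every Banach space with a
  Schauder basis is isometrically isomorphic to such a pair in the type \<open>nat \<Rightarrow> real\<close>.
\<close>

definition normed_space_on :: "'a::real_vector set \<Rightarrow> ('a \<Rightarrow> real) \<Rightarrow> bool"
  where "normed_space_on X N \<longleftrightarrow>
    subspace X \<and>
    (\<forall>x\<in>X. 0 \<le> N x \<and> (N x = 0 \<longleftrightarrow> x = 0)) \<and>
    (\<forall>c. \<forall>x\<in>X. N (c *\<^sub>R x) = \<bar>c\<bar> * N x) \<and>
    (\<forall>x\<in>X. \<forall>y\<in>X. N (x + y) \<le> N x + N y)"

definition norm_tendsto :: "('a::real_vector \<Rightarrow> real) \<Rightarrow> (nat \<Rightarrow> 'a) \<Rightarrow> 'a \<Rightarrow> bool"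
  where "norm_tendsto N s l \<longleftrightarrow> (\<lambda>n. N (s n - l)) \<longlonglongrightarrow> 0"

definition norm_Cauchy :: "('a::real_vector \<Rightarrow> real) \<Rightarrow> (nat \<Rightarrow> 'a) \<Rightarrow> bool"
  where "norm_Cauchy N s \<longleftrightarrow> (\<forall>e>0. \<exists>M. \<forall>m\<ge>M. \<forall>n\<ge>M. N (s m - s n) < e)"

definition norm_sums :: "('a::real_vector \<Rightarrow> real) \<Rightarrow> (nat \<Rightarrow> 'a) \<Rightarrow> 'a \<Rightarrow> bool"
  where "norm_sums N u x \<longleftrightarrow> norm_tendsto N (\<lambda>n. \<Sum>i<n. u i) x"

definition banach_space_on :: "'a::real_vector set \<Rightarrow> ('a \<Rightarrow> real) \<Rightarrow> bool"
  where "banach_space_on X N \<longleftrightarrow>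
    normed_space_on X N \<and>
    (\<forall>s. (\<forall>n. s n \<in> X) \<and> norm_Cauchy N s \<longrightarrow> (\<exists>l\<in>X. norm_tendsto N s l))"

section \<open>Schauder bases\<close>

definition schauder_basis_on ::
    "'a::real_vector set \<Rightarrow> ('a \<Rightarrow> real) \<Rightarrow> (nat \<Rightarrow> 'a) \<Rightarrow> bool"
  where "schauder_basis_on X N f \<longleftrightarrow>
    (\<forall>n. f n \<in> X) \<and> (\<forall>x\<in>X. \<exists>!a. norm_sums N (\<lambda>n. a n *\<^sub>R f n) x)"

text \<open>
  The equality of norms for two series includes the assertion that the series with changed signs
  converges.
\<close>

definition one_unconditional_on ::
    "'a::real_vector set \<Rightarrow> ('a \<Rightarrow> real) \<Rightarrow> (nat \<Rightarrow> 'a) \<Rightarrow> bool"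
  where "one_unconditional_on X N f \<longleftrightarrow>
    (\<forall>a x \<theta>. x \<in> X \<and> norm_sums N (\<lambda>n. a n *\<^sub>R f n) x \<and> (\<forall>n. \<theta> n \<in> {-1, 1}) \<longrightarrow>
      (\<exists>y\<in>X. norm_sums N (\<lambda>n. (\<theta> n * a n) *\<^sub>R f n) y \<and> N y = N x))"

section \<open>Isomorphisms and the Banach--Mazur distance\<close>

definition bounded_linear_between ::
    "'a::real_vector set \<Rightarrow> ('a \<Rightarrow> real) \<Rightarrow> 'b::real_vector set \<Rightarrow> ('b \<Rightarrow> real) \<Rightarrow> ('a \<Rightarrow> 'b) \<Rightarrow> bool"
  where "bounded_linear_between X N Y M T \<longleftrightarrow>
    T ` X \<subseteq> Y \<and>
    (\<forall>x\<in>X. \<forall>y\<in>X. T (x + y) = T x + T y) \<and>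
    (\<forall>c. \<forall>x\<in>X. T (c *\<^sub>R x) = c *\<^sub>R T x) \<and>
    (\<exists>K. \<forall>x\<in>X. M (T x) \<le> K * N x)"

definition operator_norm ::
    "'a::real_vector set \<Rightarrow> ('a \<Rightarrow> real) \<Rightarrow> ('b::real_vector \<Rightarrow> real) \<Rightarrow> ('a \<Rightarrow> 'b) \<Rightarrow> real"
  where "operator_norm X N M T = Sup {M (T x) | x. x \<in> X \<and> N x \<le> 1}"

definition isomorphism_between ::
    "'a::real_vector set \<Rightarrow> ('a \<Rightarrow> real) \<Rightarrow> 'b::real_vector set \<Rightarrow> ('b \<Rightarrow> real) \<Rightarrow> ('a \<Rightarrow> 'b) \<Rightarrow> bool"
  where "isomorphism_between X N Y M T \<longleftrightarrow>
    bij_betw T X Y \<and>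
    bounded_linear_between X N Y M T \<and>
    bounded_linear_between Y M X N (inv_into X T)"

definition isomorphic_spaces ::
    "'a::real_vector set \<Rightarrow> ('a \<Rightarrow> real) \<Rightarrow> 'b::real_vector set \<Rightarrow> ('b \<Rightarrow> real) \<Rightarrow> bool"
  where "isomorphic_spaces X N Y M \<longleftrightarrow> (\<exists>T. isomorphism_between X N Y M T)"

text \<open>Only meaningful for isomorphic spaces: otherwise this is the infimum of the empty set.\<close>

definition banach_mazur_dist ::
    "'a::real_vector set \<Rightarrow> ('a \<Rightarrow> real) \<Rightarrow> 'b::real_vector set \<Rightarrow> ('b \<Rightarrow> real) \<Rightarrow> real"
  where "banach_mazur_dist X N Y M =
    Inf {operator_norm X N M T * operator_norm Y M N (inv_into X T) | T.
         isomorphism_between X N Y M T}"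

text \<open>A subspace is a closed one, that is, one that is complete for the restricted norm.\<close>

definition contains_isomorphic_copy ::
    "'b::real_vector set \<Rightarrow> ('b \<Rightarrow> real) \<Rightarrow> 'a::real_vector set \<Rightarrow> ('a \<Rightarrow> real) \<Rightarrow> bool"
  where "contains_isomorphic_copy Z M X N \<longleftrightarrow>
    (\<exists>Y. Y \<subseteq> Z \<and> banach_space_on Y M \<and> isomorphic_spaces X N Y M)"

definition contained_almost_isometrically ::
    "'a::real_vector set \<Rightarrow> ('a \<Rightarrow> real) \<Rightarrow> 'b::real_vector set \<Rightarrow> ('b \<Rightarrow> real) \<Rightarrow> bool"
  where "contained_almost_isometrically X N Z M \<longleftrightarrow>
    (\<forall>\<epsilon>>0. \<exists>Y. Y \<subseteq> Z \<and> banach_space_on Y M \<and> isomorphic_spaces X N Y M \<and>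
      banach_mazur_dist X N Y M < 1 + \<epsilon>)"

section \<open>The spaces of p-summable sequences\<close>

definition lp_space :: "real \<Rightarrow> (nat \<Rightarrow> real) set"
  where "lp_space p = {x. summable (\<lambda>n. \<bar>x n\<bar> powr p)}"

definition lp_norm :: "real \<Rightarrow> (nat \<Rightarrow> real) \<Rightarrow> real"
  where "lp_norm p x = (\<Sum>n. \<bar>x n\<bar> powr p) powr (1 / p)"

end

theory Submission
  imports Defs "HOL-Analysis.Convex" "HOL-Library.Nat_Bijection"
begin

text \<open>
  Arrange a countable index set as levels \<open>0, 1, 2, \<dots>\<close>. An exponent \<open>p \<ge> 1\<close> determines a branch: at
  level \<open>n\<close> it passes through the node given by the dyadic interval of length \<open>1 / 2 ^ n\<close> that
  contains \<open>p\<close>. The space \<open>Z\<close> is the closed span of the unit vectors under the norm that takes the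
  supremum, over all branches, of the \<open>\<ell>\<^sup>p\<close> norm of the restriction to the branch of \<open>p\<close>. All these
  seminorms depend only on the absolute values of the coordinates, so the unit vectors form a
  1-unconditional basis (locale \<open>solid_seminorms\<close>).

  Now place a sequence \<open>x \<in> \<ell>\<^sup>p\<close> on the nodes of the branch of \<open>p\<close> from level \<open>m\<close> on. The branch of
  \<open>p\<close> itself gives back the norm of \<open>x\<close>, so the norm can only grow. The branch of another exponent
  \<open>q\<close> sees only the entries at shared nodes. If \<open>n\<close> is the largest shared level considered, there
  are at most \<open>n + 1\<close> such entries, while \<open>\<bar>p - q\<bar> \<le> 1 / 2 ^ n\<close>. On a finite set \<open>A\<close> the
  \<open>\<ell>\<^sup>q\<close> norm is at most \<open>1 + card A * \<bar>p - q\<bar>\<close> times the \<open>\<ell>\<^sup>p\<close> norm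
  (\<open>fin_lp_change_exponent\<close>), so the \<open>q\<close>-branch contributes at most \<open>1 + (n + 1) / 2 ^ n\<close> times the norm
  of \<open>x\<close>, and \<open>n \<ge> m\<close> whenever anything is shared at all (\<open>place_bound\<close>). Since
  \<open>(n + 1) / 2 ^ n\<close> tends to \<open>0\<close>, starting at a high level \<open>m\<close> makes the embedding of \<open>\<ell>\<^sup>p\<close> as
  close to an isometry as desired.
\<close>

section \<open>The p-norm on a finite set of coordinates\<close>

definition fin_lp :: "real \<Rightarrow> 'a set \<Rightarrow> ('a \<Rightarrow> real) \<Rightarrow> real"
  where "fin_lp p A x = (\<Sum>i\<in>A. \<bar>x i\<bar> powr p) powr (1 / p)"

lemma fin_lp_nonneg [simp]: "0 \<le> fin_lp p A x"
  by (simp add: fin_lp_def)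

lemma powr_le_iff_le_powr_inverse:
  fixes s b p :: real
  assumes "0 \<le> s" "0 \<le> b" "1 \<le> p"
  shows "s powr (1 / p) \<le> b \<longleftrightarrow> s \<le> b powr p"
proof
  assume "s powr (1 / p) \<le> b"
  then have "(s powr (1 / p)) powr p \<le> b powr p"
    using assms by (intro powr_mono2) auto
  then show "s \<le> b powr p"
    using assms by (simp add: powr_powr)
next
  assume "s \<le> b powr p"
  then have "s powr (1 / p) \<le> (b powr p) powr (1 / p)"
    using assms by (intro powr_mono2) auto
  then show "s powr (1 / p) \<le> b"
    using assms by (simp add: powr_powr)
qed

text \<open>
  Stating bounds as bounds on the normalized sum turns estimates of norms into pointwise estimates of
  powers, which is how both the triangle inequality and the change of exponent are proved.
\<close>

lemma fin_lp_le_iff: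
  assumes "1 \<le> p" "0 < B"
  shows "fin_lp p A x \<le> B \<longleftrightarrow> (\<Sum>i\<in>A. (\<bar>x i\<bar> / B) powr p) \<le> 1"
proof -
  have "fin_lp p A x \<le> B \<longleftrightarrow> (\<Sum>i\<in>A. \<bar>x i\<bar> powr p) \<le> B powr p"
    unfolding fin_lp_def using assms by (intro powr_le_iff_le_powr_inverse) (auto simp: sum_nonneg)
  also have "\<dots> \<longleftrightarrow> (\<Sum>i\<in>A. \<bar>x i\<bar> powr p) / B powr p \<le> 1"
    using assms by (simp add: divide_le_eq_1)
  also have "(\<Sum>i\<in>A. \<bar>x i\<bar> powr p) / B powr p = (\<Sum>i\<in>A. (\<bar>x i\<bar> / B) powr p)"
    using assms by (simp add: sum_divide_distrib powr_divide)
  finally show ?thesis .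
qed

lemma fin_lp_mono:
  assumes "1 \<le> p" "\<And>i. i \<in> A \<Longrightarrow> \<bar>x i\<bar> \<le> \<bar>y i\<bar>"
  shows "fin_lp p A x \<le> fin_lp p A y"
  unfolding fin_lp_def using assms
  by (intro powr_mono2 sum_mono sum_nonneg) auto

lemma fin_lp_scale:
  assumes "1 \<le> p"
  shows "fin_lp p A (\<lambda>i. c * x i) = \<bar>c\<bar> * fin_lp p A x"
proof -
  have "(\<Sum>i\<in>A. \<bar>c * x i\<bar> powr p) = \<bar>c\<bar> powr p * (\<Sum>i\<in>A. \<bar>x i\<bar> powr p)"
    by (simp add: abs_mult powr_mult sum_distrib_left)
  then show ?thesis
    using assms by (simp add: fin_lp_def powr_mult sum_nonneg powr_powr)
qed

text \<open>
  Sequences have zero entries, so the point \<open>0\<close> has to be included; there convexity amounts to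
  \<open>t powr p \<le> t\<close> for \<open>0 < t < 1\<close>.
\<close>

lemma powr_convex_nonneg:
  fixes p :: real
  assumes "1 \<le> p"
  shows "convex_on {0..} (\<lambda>x. x powr p)"
proof (rule convex_onI)
  fix t x y :: real
  assume t: "0 < t" "t < 1" and xy: "x \<in> {0..}" "y \<in> {0..}"
  have small: "u powr p \<le> u" if "0 < u" "u < 1" for u :: real
    using powr_mono'[of 1 p u] that assms by simp
  consider "x = 0" | "y = 0" | "0 < x" "0 < y"
    using xy by fastforce
  then show "((1 - t) *\<^sub>R x + t *\<^sub>R y) powr p \<le> (1 - t) * x powr p + t * y powr p"
  proof cases
    case 1
    then show ?thesis
      using small[of t] t xy by (auto simp: powr_mult intro!: mult_right_mono)
  next
    case 2
    then show ?thesis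
      using small[of "1 - t"] t xy by (auto simp: powr_mult intro!: mult_right_mono)
  next
    case 3
    then show ?thesis
      using convex_onD[OF powr_convex[OF assms], of t x y] t by simp
  qed
qed simp

text \<open>
  Minkowski's inequality. If \<open>a\<close> and \<open>b\<close> are positive upper bounds of the two norms, then
  \<open>(x + y) / (a + b)\<close> is the convex combination of \<open>x / a\<close> and \<open>y / b\<close> with weights
  \<open>a / (a + b)\<close> and \<open>b / (a + b)\<close>, and convexity of the power bounds its normalized sum by \<open>1\<close>.
  Using upper bounds rather than the norms themselves avoids a case distinction on zero norms.
\<close>

theorem fin_lp_triangle:
  assumes p: "1 \<le> p" and fin: "finite A"
  shows "fin_lp p A (\<lambda>i. x i + y i) \<le> fin_lp p A x + fin_lp p A y"
proof -
  have shrink: "fin_lp p A (\<lambda>i. x i + y i) \<le> a + b"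
    if a: "fin_lp p A x \<le> a" "0 < a" and b: "fin_lp p A y \<le> b" "0 < b" for a b
  proof -
    have "(\<bar>x i + y i\<bar> / (a + b)) powr p
        \<le> (a / (a + b)) * (\<bar>x i\<bar> / a) powr p + (b / (a + b)) * (\<bar>y i\<bar> / b) powr p" for i
    proof -
      have "(\<bar>x i + y i\<bar> / (a + b)) powr p
          \<le> ((1 - b / (a + b)) *\<^sub>R (\<bar>x i\<bar> / a) + (b / (a + b)) *\<^sub>R (\<bar>y i\<bar> / b)) powr p"
      proof (rule powr_mono2)
        have "1 - b / (a + b) = a / (a + b)"
          using a b by (simp add: field_simps)
        then show "\<bar>x i + y i\<bar> / (a + b)
            \<le> (1 - b / (a + b)) *\<^sub>R (\<bar>x i\<bar> / a) + (b / (a + b)) *\<^sub>R (\<bar>y i\<bar> / b)"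
          using a b by (simp add: add_divide_distrib[symmetric] divide_right_mono)
      qed (use p a b in auto)
      also have "\<dots> \<le> (1 - b / (a + b)) * (\<bar>x i\<bar> / a) powr p + (b / (a + b)) * (\<bar>y i\<bar> / b) powr p"
        using a b by (intro convex_onD[OF powr_convex_nonneg[OF p]]) auto
      also have "1 - b / (a + b) = a / (a + b)"
        using a b by (simp add: field_simps)
      finally show ?thesis .
    qed
    then have "(\<Sum>i\<in>A. (\<bar>x i + y i\<bar> / (a + b)) powr p)
        \<le> (\<Sum>i\<in>A. (a / (a + b)) * (\<bar>x i\<bar> / a) powr p + (b / (a + b)) * (\<bar>y i\<bar> / b) powr p)"
      by (intro sum_mono)
    also have "\<dots> = (a / (a + b)) * (\<Sum>i\<in>A. (\<bar>x i\<bar> / a) powr p)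
        + (b / (a + b)) * (\<Sum>i\<in>A. (\<bar>y i\<bar> / b) powr p)"
      by (simp add: sum.distrib sum_distrib_left)
    also have "\<dots> \<le> (a / (a + b)) * 1 + (b / (a + b)) * 1"
      using a b p by (intro add_mono mult_left_mono) (auto simp: fin_lp_le_iff)
    also have "\<dots> = 1"
      using a b by (simp add: add_divide_distrib[symmetric])
    finally show ?thesis
      using a b p by (simp add: fin_lp_le_iff)
  qed
  show ?thesis
  proof (rule field_le_epsilon)
    fix e :: real
    assume "0 < e"
    then have "fin_lp p A (\<lambda>i. x i + y i) \<le> (fin_lp p A x + e / 2) + (fin_lp p A y + e / 2)"
      by (intro shrink) (auto intro: add_nonneg_pos)
    then show "fin_lp p A (\<lambda>i. x i + y i) \<le> fin_lp p A x + fin_lp p A y + e"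
      by simp
  qed
qed

lemma fin_lp_tendsto:
  assumes p: "1 \<le> p" and lim: "\<And>i. (\<lambda>n. s n i) \<longlonglongrightarrow> x i"
  shows "(\<lambda>n. fin_lp p A (s n)) \<longlonglongrightarrow> fin_lp p A x"
  unfolding fin_lp_def using p
  by (intro tendsto_powr' tendsto_sum tendsto_rabs lim tendsto_const)
     (auto intro!: always_eventually sum_nonneg)

text \<open>
  For \<open>q < p\<close>, writing \<open>d = p - q\<close>, one has \<open>1 \<le> u powr d - d * ln u\<close>, and \<open>- ln u \<le> 1 / u\<close>; multiplying by
  \<open>u powr q\<close> leaves the error \<open>d * u powr (q - 1) \<le> d\<close>.
\<close>

lemma powr_le_powr_add_diff:
  fixes u p q :: real
  assumes u: "0 \<le> u" "u \<le> 1" and pq: "1 \<le> p" "1 \<le> q"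
  shows "u powr q \<le> u powr p + \<bar>p - q\<bar>"
proof (cases "p \<le> q \<or> u = 0")
  case True
  then show ?thesis
    using powr_mono'[of p q u] u pq by auto
next
  case False
  then have "0 < u" "q < p"
    using u by auto
  have "1 + (p - q) * ln u \<le> u powr (p - q)"
    using \<open>0 < u\<close> exp_ge_add_one_self[of "(p - q) * ln u"] by (simp add: powr_def)
  moreover have "- ln u \<le> 1 / u"
    using ln_le_minus_one[of "1 / u"] \<open>0 < u\<close> by (simp add: ln_div)
  then have "(p - q) * - ln u \<le> (p - q) * (1 / u)"
    using \<open>q < p\<close> by (intro mult_left_mono) auto
  ultimately have "1 \<le> u powr (p - q) + (p - q) / u"
    by simp
  then have "u powr q * 1 \<le> u powr q * (u powr (p - q) + (p - q) / u)"
    by (intro mult_left_mono) auto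
  also have "\<dots> = u powr p + (p - q) * u powr (q - 1)"
    using \<open>0 < u\<close> powr_add[of u q "p - q"] by (simp add: distrib_left powr_diff)
  also have "\<dots> \<le> u powr p + (p - q) * 1"
    using \<open>q < p\<close> u pq by (intro add_left_mono mult_left_mono powr_le1) auto
  finally show ?thesis
    using \<open>q < p\<close> by simp
qed

text \<open>
  Cruder than the optimal constant, a power of \<open>card A\<close>, but linear in \<open>\<bar>p - q\<bar>\<close>,
  symmetric in the two exponents, and still tending to \<open>1\<close> when \<open>\<bar>p - q\<bar>\<close> is small compared with
  \<open>1 / card A\<close>.
\<close>

lemma fin_lp_change_exponent:
  fixes p q :: real
  assumes pq: "1 \<le> p" "1 \<le> q" and fin: "finite A"
  shows "fin_lp q A x \<le> (1 + card A * \<bar>p - q\<bar>) * fin_lp p A x"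
proof -
  let ?K = "1 + card A * \<bar>p - q\<bar>"
  have K: "1 \<le> ?K" by simp
  have main: "fin_lp q A x \<le> ?K * b" if b: "fin_lp p A x \<le> b" "0 < b" for b :: real
  proof -
    have sum1: "(\<Sum>i\<in>A. (\<bar>x i\<bar> / b) powr p) \<le> 1"
      using b pq by (simp add: fin_lp_le_iff)
    have "\<bar>x i\<bar> / b \<le> 1" if "i \<in> A" for i
    proof -
      have "(\<bar>x i\<bar> / b) powr p \<le> 1"
        using member_le_sum[OF that, of "\<lambda>i. (\<bar>x i\<bar> / b) powr p"] fin sum1 by simp
      moreover have "1 < (\<bar>x i\<bar> / b) powr p" if "1 < \<bar>x i\<bar> / b"
        using that pq by (intro gr_one_powr) auto
      ultimately show ?thesis
        by fastforce
    qed
    then have "(\<Sum>i\<in>A. (\<bar>x i\<bar> / b) powr q) \<le> (\<Sum>i\<in>A. (\<bar>x i\<bar> / b) powr p + \<bar>p - q\<bar>)"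
      using b pq by (intro sum_mono powr_le_powr_add_diff) auto
    also have "\<dots> \<le> ?K"
      using sum1 by (simp add: sum.distrib)
    finally have "(\<Sum>i\<in>A. (\<bar>x i\<bar> / b) powr q) \<le> ?K" .
    moreover have "(\<Sum>i\<in>A. (\<bar>x i\<bar> / (?K * b)) powr q) = (\<Sum>i\<in>A. (\<bar>x i\<bar> / b) powr q) / ?K powr q"
      using K b by (simp add: sum_divide_distrib powr_divide[symmetric] field_simps)
    moreover have "?K \<le> ?K powr q"
      using powr_mono[of 1 q ?K] K pq by simp
    ultimately have "(\<Sum>i\<in>A. (\<bar>x i\<bar> / (?K * b)) powr q) \<le> 1"
      using K by (simp add: divide_le_eq_1 order_less_le_trans[OF _ \<open>?K \<le> ?K powr q\<close>])
    then show ?thesis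
      using fin_lp_le_iff[OF pq(2), of "?K * b" A x] K b by (simp add: add_pos_nonneg)
  qed
  show ?thesis
  proof (rule field_le_epsilon)
    fix e :: real
    assume e: "0 < e"
    have "fin_lp q A x \<le> ?K * (fin_lp p A x + e / ?K)"
      using e K by (intro main add_nonneg_pos divide_pos_pos order_less_le_trans[OF zero_less_one K]) auto
    then show "fin_lp q A x \<le> ?K * fin_lp p A x + e"
      using K by (simp add: distrib_left)
  qed
qed


section \<open>Banach spaces with an unconditional basis from solid seminorms\<close>

definition unit :: "nat \<Rightarrow> nat \<Rightarrow> real"
  where "unit k = (\<lambda>i. if i = k then 1 else 0)"

definition tail :: "nat \<Rightarrow> (nat \<Rightarrow> real) \<Rightarrow> nat \<Rightarrow> real"
  where "tail n x = (\<lambda>k. if n \<le> k then x k else 0)"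

lemma tail_add: "tail n (x + y) = tail n x + tail n y"
  by (auto simp: tail_def fun_eq_iff)

lemma tail_scale: "tail n (c *\<^sub>R x) = c *\<^sub>R tail n x"
  by (auto simp: tail_def fun_eq_iff scaleR_fun_def)

lemma sum_unit: "(\<Sum>i<n. a i *\<^sub>R unit i) = (\<lambda>k. if k < n then a k else 0)"
proof (induction n)
  case 0
  then show ?case
    by (simp add: fun_eq_iff)
next
  case (Suc n)
  then show ?case
    by (auto simp: fun_eq_iff unit_def scaleR_fun_def less_Suc_eq)
qed

lemma sum_unit_minus: "(\<Sum>i<n. x i *\<^sub>R unit i) - x = - tail n x"
  by (auto simp: sum_unit tail_def fun_eq_iff)

text \<open>
  The supremum of a family of solid seminorms, each continuous for pointwise convergence, is
  a lower semicontinuous extended norm; the conditions \<open>coordinate\<close> and \<open>unit_le\<close> make it dominate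
  every coordinate and stay bounded on the unit vectors.
\<close>

locale solid_seminorms =
  fixes P :: "((nat \<Rightarrow> real) \<Rightarrow> real) set"
  assumes scale: "\<phi> \<in> P \<Longrightarrow> \<phi> (c *\<^sub>R x) = \<bar>c\<bar> * \<phi> x"
    and triangle: "\<phi> \<in> P \<Longrightarrow> \<phi> (x + y) \<le> \<phi> x + \<phi> y"
    and solid: "\<phi> \<in> P \<Longrightarrow> (\<And>k. \<bar>x k\<bar> \<le> \<bar>y k\<bar>) \<Longrightarrow> \<phi> x \<le> \<phi> y"
    and continuous: "\<phi> \<in> P \<Longrightarrow> (\<And>k. (\<lambda>n. s n k) \<longlonglongrightarrow> x k) \<Longrightarrow> (\<lambda>n. \<phi> (s n)) \<longlonglongrightarrow> \<phi> x"
    and coordinate: "\<exists>\<phi>\<in>P. \<forall>x. \<bar>x k\<bar> \<le> \<phi> x"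
    and unit_le: "\<phi> \<in> P \<Longrightarrow> \<phi> (unit k) \<le> 1"
begin

text \<open>
  The vectors whose tails tend to zero uniformly over the family. For them the supremum is
  finite, and they are exactly the limits of their finite initial segments, so this is the closed
  span of the unit vectors without any abstract completion.
\<close>

definition space :: "(nat \<Rightarrow> real) set"
  where "space = {x. \<forall>e>0. \<exists>n. \<forall>\<phi>\<in>P. \<phi> (tail n x) \<le> e}"

definition sup_norm :: "(nat \<Rightarrow> real) \<Rightarrow> real"
  where "sup_norm x = (SUP \<phi>\<in>P. \<phi> x)"

lemma spaceD: "x \<in> space \<Longrightarrow> 0 < e \<Longrightarrow> \<exists>n. \<forall>\<phi>\<in>P. \<phi> (tail n x) \<le> e"
  by (simp add: space_def)

lemma nonempty: "P \<noteq> {}"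
  using coordinate by blast

lemma zero [simp]: "\<phi> \<in> P \<Longrightarrow> \<phi> 0 = 0"
  using scale[of \<phi> 0 0] by simp

lemma nonneg: "\<phi> \<in> P \<Longrightarrow> 0 \<le> \<phi> x"
  using solid[of \<phi> 0 x] by simp

lemma seminorm_uminus: "\<phi> \<in> P \<Longrightarrow> \<phi> (- x) = \<phi> x"
  using scale[of \<phi> "-1" x] by simp

lemma seminorm_initial_le: "\<phi> \<in> P \<Longrightarrow> \<phi> (\<lambda>k. if k < n then x k else 0) \<le> (\<Sum>k<n. \<bar>x k\<bar>)"
proof (induction n)
  case 0
  then show ?case
    using zero[of \<phi>] by (simp add: zero_fun_def)
next
  case (Suc n)
  have "(\<lambda>k. if k < Suc n then x k else 0) = (\<lambda>k. if k < n then x k else 0) + x n *\<^sub>R unit n"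
    by (auto simp: fun_eq_iff unit_def scaleR_fun_def less_Suc_eq)
  then have "\<phi> (\<lambda>k. if k < Suc n then x k else 0)
      \<le> \<phi> (\<lambda>k. if k < n then x k else 0) + \<bar>x n\<bar> * \<phi> (unit n)"
    using triangle[OF Suc.prems] scale[OF Suc.prems] by metis
  also have "\<dots> \<le> (\<Sum>k<n. \<bar>x k\<bar>) + \<bar>x n\<bar> * 1"
    using Suc unit_le[of \<phi> n] by (intro add_mono mult_left_mono) auto
  finally show ?case
    by simp
qed

lemma space_bdd_above: "x \<in> space \<Longrightarrow> bdd_above ((\<lambda>\<phi>. \<phi> x) ` P)"
proof -
  assume "x \<in> space"
  then obtain n where n: "\<And>\<phi>. \<phi> \<in> P \<Longrightarrow> \<phi> (tail n x) \<le> 1"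
    using spaceD[of x 1] by auto
  have "\<phi> x \<le> (\<Sum>k<n. \<bar>x k\<bar>) + 1" if "\<phi> \<in> P" for \<phi>
  proof -
    have "x = (\<lambda>k. if k < n then x k else 0) + tail n x"
      by (auto simp: fun_eq_iff tail_def)
    then have "\<phi> x \<le> \<phi> (\<lambda>k. if k < n then x k else 0) + \<phi> (tail n x)"
      using triangle[OF that] by metis
    then show ?thesis
      using seminorm_initial_le[OF that, of n x] n[OF that] by linarith
  qed
  then show ?thesis
    by (auto simp: bdd_above_def)
qed

lemma le_norm: "x \<in> space \<Longrightarrow> \<phi> \<in> P \<Longrightarrow> \<phi> x \<le> sup_norm x"
  unfolding sup_norm_def by (rule cSUP_upper[OF _ space_bdd_above])

lemma norm_le: "(\<And>\<phi>. \<phi> \<in> P \<Longrightarrow> \<phi> x \<le> c) \<Longrightarrow> sup_norm x \<le> c"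
  unfolding sup_norm_def using nonempty by (rule cSUP_least)

lemma norm_nonneg: "x \<in> space \<Longrightarrow> 0 \<le> sup_norm x"
proof -
  assume x: "x \<in> space"
  obtain \<phi> where "\<phi> \<in> P"
    using nonempty by blast
  then show ?thesis
    using nonneg[of \<phi> x] le_norm[OF x] by fastforce
qed

lemma coordinate_le_norm: "x \<in> space \<Longrightarrow> \<bar>x k\<bar> \<le> sup_norm x"
proof -
  assume x: "x \<in> space"
  obtain \<phi> where "\<phi> \<in> P" "\<bar>x k\<bar> \<le> \<phi> x"
    using coordinate by blast
  then show ?thesis
    using le_norm[OF x] by fastforce
qed

lemma space_solid:
  assumes x: "x \<in> space" and le: "\<And>k. \<bar>y k\<bar> \<le> \<bar>x k\<bar>"
  shows "y \<in> space"
  unfolding space_def mem_Collect_eq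
proof (intro allI impI)
  fix e :: real
  assume "0 < e"
  obtain n where n: "\<And>\<phi>. \<phi> \<in> P \<Longrightarrow> \<phi> (tail n x) \<le> e"
    using spaceD[OF x \<open>0 < e\<close>] by blast
  have "\<phi> (tail n y) \<le> e" if "\<phi> \<in> P" for \<phi>
  proof -
    have "\<phi> (tail n y) \<le> \<phi> (tail n x)"
      using le by (intro solid[OF that]) (simp add: tail_def)
    then show ?thesis
      using n[OF that] by linarith
  qed
  then show "\<exists>n. \<forall>\<phi>\<in>P. \<phi> (tail n y) \<le> e"
    by blast
qed

lemma norm_solid:
  assumes x: "x \<in> space" and le: "\<And>k. \<bar>y k\<bar> \<le> \<bar>x k\<bar>"
  shows "sup_norm y \<le> sup_norm x"
proof (rule norm_le)
  fix \<phi>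
  assume "\<phi> \<in> P"
  then show "\<phi> y \<le> sup_norm x"
    using solid[of \<phi> y x] le le_norm[OF x, of \<phi>] by force
qed

lemma tail_in_space: "x \<in> space \<Longrightarrow> tail n x \<in> space"
  by (erule space_solid) (simp add: tail_def)

lemma unit_in_space: "unit k \<in> space"
proof -
  have "tail (Suc k) (unit k) = 0"
    by (auto simp: tail_def unit_def fun_eq_iff)
  then show ?thesis
    unfolding space_def by (auto intro!: exI[of _ "Suc k"])
qed

text \<open>
  The tail condition is stable under limits that are uniform over the family, since cutting off an
  initial segment does not increase any of the seminorms.
\<close>

lemma space_by_approximation:
  assumes "\<And>e. 0 < e \<Longrightarrow> \<exists>y\<in>space. \<forall>\<phi>\<in>P. \<phi> (x - y) \<le> e"
  shows "x \<in> space"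
  unfolding space_def mem_Collect_eq
proof (intro allI impI)
  fix e :: real
  assume "0 < e"
  then obtain y where y: "y \<in> space" "\<And>\<phi>. \<phi> \<in> P \<Longrightarrow> \<phi> (x - y) \<le> e / 2"
    using assms[of "e / 2"] by auto
  obtain n where n: "\<And>\<phi>. \<phi> \<in> P \<Longrightarrow> \<phi> (tail n y) \<le> e / 2"
    using spaceD[OF y(1) half_gt_zero[OF \<open>0 < e\<close>]] by blast
  have "\<phi> (tail n x) \<le> e" if "\<phi> \<in> P" for \<phi>
  proof -
    have "\<phi> (tail n x) \<le> \<phi> (tail n (x - y)) + \<phi> (tail n y)"
      using triangle[OF that, of "tail n (x - y)" "tail n y"] by (simp flip: tail_add)
    moreover have "\<phi> (tail n (x - y)) \<le> \<phi> (x - y)"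
      by (rule solid[OF that]) (auto simp: tail_def)
    ultimately show ?thesis
      using y(2)[OF that] n[OF that] by linarith
  qed
  then show "\<exists>n. \<forall>\<phi>\<in>P. \<phi> (tail n x) \<le> e"
    by blast
qed

lemma subspace_space: "subspace space"
proof (rule subspaceI)
  show "0 \<in> space"
    by (rule space_solid[OF unit_in_space[of 0]]) simp
next
  fix x y
  assume x: "x \<in> space" and y: "y \<in> space"
  show "x + y \<in> space"
    unfolding space_def mem_Collect_eq
  proof (intro allI impI)
    fix e :: real
    assume "0 < e"
    obtain m where m: "\<And>\<phi>. \<phi> \<in> P \<Longrightarrow> \<phi> (tail m x) \<le> e / 2"
      using spaceD[OF x half_gt_zero[OF \<open>0 < e\<close>]] by blast
    obtain n where n: "\<And>\<phi>. \<phi> \<in> P \<Longrightarrow> \<phi> (tail n y) \<le> e / 2"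
      using spaceD[OF y half_gt_zero[OF \<open>0 < e\<close>]] by blast
    have "\<phi> (tail (max m n) (x + y)) \<le> e" if "\<phi> \<in> P" for \<phi>
    proof -
      have "\<phi> (tail (max m n) (x + y)) \<le> \<phi> (tail (max m n) x) + \<phi> (tail (max m n) y)"
        unfolding tail_add by (rule triangle[OF that])
      moreover have "\<phi> (tail (max m n) x) \<le> \<phi> (tail m x)"
        by (rule solid[OF that]) (auto simp: tail_def)
      moreover have "\<phi> (tail (max m n) y) \<le> \<phi> (tail n y)"
        by (rule solid[OF that]) (auto simp: tail_def)
      ultimately show ?thesis
        using m[OF that] n[OF that] by linarith
    qed
    then show "\<exists>n. \<forall>\<phi>\<in>P. \<phi> (tail n (x + y)) \<le> e"
      by blast
  qed
next
  fix c x
  assume x: "x \<in> space"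
  show "c *\<^sub>R x \<in> space"
    unfolding space_def mem_Collect_eq
  proof (intro allI impI)
    fix e :: real
    assume "0 < e"
    then have "0 < e / (\<bar>c\<bar> + 1)"
      by (simp add: add_nonneg_pos)
    then obtain n where n: "\<And>\<phi>. \<phi> \<in> P \<Longrightarrow> \<phi> (tail n x) \<le> e / (\<bar>c\<bar> + 1)"
      using spaceD[OF x] by blast
    have "\<phi> (tail n (c *\<^sub>R x)) \<le> e" if "\<phi> \<in> P" for \<phi>
    proof -
      have "\<phi> (tail n (c *\<^sub>R x)) = \<bar>c\<bar> * \<phi> (tail n x)"
        unfolding tail_scale by (rule scale[OF that])
      also have "\<dots> \<le> (\<bar>c\<bar> + 1) * (e / (\<bar>c\<bar> + 1))"
        using n[OF that] nonneg[OF that] by (intro mult_mono) auto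
      also have "\<dots> = e"
        by (simp add: add_nonneg_pos less_imp_neq[symmetric])
      finally show ?thesis .
    qed
    then show "\<exists>n. \<forall>\<phi>\<in>P. \<phi> (tail n (c *\<^sub>R x)) \<le> e"
      by blast
  qed
qed

lemma normed_space: "normed_space_on space sup_norm"
  unfolding normed_space_on_def
proof (intro conjI ballI allI subspace_space norm_nonneg)
  fix x assume x: "x \<in> space"
  show "sup_norm x = 0 \<longleftrightarrow> x = 0"
  proof
    assume "sup_norm x = 0"
    then show "x = 0"
      using coordinate_le_norm[OF x] by (auto simp: fun_eq_iff)
  next
    assume "x = 0"
    then show "sup_norm x = 0"
      using norm_nonneg[OF x] norm_le[of x 0] by auto
  qed
next
  fix c x assume x: "x \<in> space"
  have "sup_norm (c *\<^sub>R x) \<le> \<bar>c\<bar> * sup_norm x"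
    by (intro norm_le) (simp add: scale mult_left_mono le_norm[OF x])
  moreover have "\<bar>c\<bar> * sup_norm x \<le> sup_norm (c *\<^sub>R x)"
  proof (cases "c = 0")
    case True
    then show ?thesis
      using norm_nonneg[OF subspace_0[OF subspace_space]] by simp
  next
    case False
    have "sup_norm x \<le> sup_norm (c *\<^sub>R x) / \<bar>c\<bar>"
    proof (rule norm_le)
      fix \<phi> assume "\<phi> \<in> P"
      then have "\<bar>c\<bar> * \<phi> x \<le> sup_norm (c *\<^sub>R x)"
        using le_norm[OF subspace_scale[OF subspace_space x], of \<phi> c] by (simp add: scale)
      then show "\<phi> x \<le> sup_norm (c *\<^sub>R x) / \<bar>c\<bar>"
        using False by (simp add: field_simps)
    qed
    then show ?thesis
      using False by (simp add: field_simps)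
  qed
  ultimately show "sup_norm (c *\<^sub>R x) = \<bar>c\<bar> * sup_norm x"
    by simp
next
  fix x y assume x: "x \<in> space" and y: "y \<in> space"
  show "sup_norm (x + y) \<le> sup_norm x + sup_norm y"
  proof (rule norm_le)
    fix \<phi> assume \<phi>: "\<phi> \<in> P"
    show "\<phi> (x + y) \<le> sup_norm x + sup_norm y"
      using triangle[OF \<phi>, of x y] le_norm[OF x \<phi>] le_norm[OF y \<phi>] by linarith
  qed
qed

lemma diff_in_space: "x \<in> space \<Longrightarrow> y \<in> space \<Longrightarrow> x - y \<in> space"
  by (rule subspace_diff[OF subspace_space])

lemma norm_tendsto_coordinate:
  assumes "\<And>n. s n - x \<in> space" "norm_tendsto sup_norm s x"
  shows "(\<lambda>n. s n k) \<longlonglongrightarrow> x k"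
proof -
  have "(\<lambda>n. s n k - x k) \<longlonglongrightarrow> 0"
    using assms(2) unfolding norm_tendsto_def
    by (rule tendsto_rabs_zero_cancel[OF tendsto_sandwich[OF _ _ tendsto_const], rotated 2])
       (use coordinate_le_norm[OF assms(1)] in auto)
  then show ?thesis
    by (simp add: LIM_zero_iff)
qed

text \<open>
  A Cauchy sequence converges in every coordinate. Passing to the limit in each single seminorm, which
  is pointwise continuous, bounds its distance to the coordinatewise limit uniformly over the family.
\<close>

lemma complete:
  assumes s: "\<And>n. s n \<in> space" and cauchy: "norm_Cauchy sup_norm s"
  obtains x where "x \<in> space" "norm_tendsto sup_norm s x"
proof -
  have "Cauchy (\<lambda>n. s n k)" for k
  proof (rule metric_CauchyI)
    fix e :: real
    assume "0 < e"
    then obtain M where "\<forall>m\<ge>M. \<forall>n\<ge>M. sup_norm (s m - s n) < e"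
      using cauchy unfolding norm_Cauchy_def by blast
    then show "\<exists>M. \<forall>m\<ge>M. \<forall>n\<ge>M. dist (s m k) (s n k) < e"
      using coordinate_le_norm[OF diff_in_space[OF s s]]
      by (metis dist_real_def minus_apply order_le_less_trans)
  qed
  then have "\<forall>k. \<exists>l. (\<lambda>n. s n k) \<longlonglongrightarrow> l"
    by (simp add: Cauchy_convergent_iff convergent_def)
  then obtain x where x: "\<And>k. (\<lambda>n. s n k) \<longlonglongrightarrow> x k"
    by metis
  have approx: "\<exists>M. \<forall>m\<ge>M. \<forall>\<phi>\<in>P. \<phi> (s m - x) \<le> e" if e: "0 < e" for e
  proof -
    obtain M where M: "\<forall>m\<ge>M. \<forall>n\<ge>M. sup_norm (s m - s n) < e"
      using cauchy e unfolding norm_Cauchy_def by blast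
    have "\<phi> (s m - x) \<le> e" if m: "M \<le> m" and \<phi>: "\<phi> \<in> P" for m \<phi>
    proof (rule tendsto_upperbound)
      show "(\<lambda>n. \<phi> (s m - s n)) \<longlonglongrightarrow> \<phi> (s m - x)"
        using x by (intro continuous[OF \<phi>]) (auto intro!: tendsto_intros)
      show "\<forall>\<^sub>F n in sequentially. \<phi> (s m - s n) \<le> e"
        using M m le_norm[OF diff_in_space[OF s s] \<phi>]
        by (intro eventually_sequentiallyI[of M]) (meson less_imp_le order_trans)
    qed simp
    then show ?thesis
      by blast
  qed
  have in_space: "x \<in> space"
  proof (rule space_by_approximation)
    fix e :: real
    assume "0 < e"
    then obtain M where "\<forall>\<phi>\<in>P. \<phi> (s M - x) \<le> e"
      using approx by blast
    then have "\<forall>\<phi>\<in>P. \<phi> (x - s M) \<le> e"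
      using seminorm_uminus by (metis minus_diff_eq)
    then show "\<exists>y\<in>space. \<forall>\<phi>\<in>P. \<phi> (x - y) \<le> e"
      using s by blast
  qed
  moreover have "norm_tendsto sup_norm s x"
    unfolding norm_tendsto_def
  proof (rule LIMSEQ_I)
    fix r :: real
    assume "0 < r"
    then obtain M where M: "\<forall>m\<ge>M. \<forall>\<phi>\<in>P. \<phi> (s m - x) \<le> r / 2"
      using approx[of "r / 2"] by auto
    have "\<bar>sup_norm (s m - x)\<bar> < r" if "M \<le> m" for m
      using norm_le[of "s m - x" "r / 2"] norm_nonneg[OF diff_in_space[OF s in_space]] M that \<open>0 < r\<close>
      by fastforce
    then show "\<exists>M. \<forall>m\<ge>M. norm (sup_norm (s m - x) - 0) < r"
      by auto
  qed
  ultimately show thesis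
    by (rule that)
qed

text \<open>
  Vanishing outside a set \<open>C\<close> of coordinates passes to limits because coordinates are continuous.
  The case \<open>C = UNIV\<close> is the completeness of the whole space.
\<close>

lemma banach_subspace:
  "banach_space_on {x \<in> space. \<forall>k. k \<notin> C \<longrightarrow> x k = 0} sup_norm" (is "banach_space_on ?Y sup_norm")
  unfolding banach_space_on_def
proof (intro conjI allI impI)
  have "subspace ?Y"
    using subspace_space by (auto simp: subspace_def scaleR_fun_def)
  then show "normed_space_on ?Y sup_norm"
    using normed_space unfolding normed_space_on_def by auto
next
  fix s
  assume s: "(\<forall>n. s n \<in> ?Y) \<and> norm_Cauchy sup_norm s"
  then obtain x where x: "x \<in> space" "norm_tendsto sup_norm s x"
    using complete[of s] by auto
  have "x k = 0" if "k \<notin> C" for k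
  proof -
    have "(\<lambda>n. s n k) \<longlonglongrightarrow> x k"
      using s x by (intro norm_tendsto_coordinate diff_in_space) auto
    then show ?thesis
      using s that LIMSEQ_unique[OF _ tendsto_const[of 0]] by simp
  qed
  with x show "\<exists>l\<in>?Y. norm_tendsto sup_norm s l"
    by auto
qed

lemma norm_sums_unit: "x \<in> space \<Longrightarrow> norm_sums sup_norm (\<lambda>n. x n *\<^sub>R unit n) x"
  unfolding norm_sums_def norm_tendsto_def sum_unit_minus
proof (rule LIMSEQ_I)
  fix r :: real
  assume x: "x \<in> space" and r: "0 < r"
  then obtain n where n: "\<And>\<phi>. \<phi> \<in> P \<Longrightarrow> \<phi> (tail n x) \<le> r / 2"
    using spaceD[of x "r / 2"] half_gt_zero by blast
  have "\<bar>sup_norm (- tail m x)\<bar> < r" if "n \<le> m" for m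
  proof -
    have "sup_norm (- tail m x) \<le> r / 2"
    proof (rule norm_le)
      fix \<phi> assume "\<phi> \<in> P"
      have "\<phi> (- tail m x) \<le> \<phi> (tail n x)"
        using that by (intro solid[OF \<open>\<phi> \<in> P\<close>]) (auto simp: tail_def)
      then show "\<phi> (- tail m x) \<le> r / 2"
        using n[OF \<open>\<phi> \<in> P\<close>] by simp
    qed
    moreover have "0 \<le> sup_norm (- tail m x)"
      using x by (intro norm_nonneg subspace_neg[OF subspace_space] tail_in_space)
    ultimately show ?thesis
      using r by simp
  qed
  then show "\<exists>n. \<forall>m\<ge>n. norm (sup_norm (- tail m x) - 0) < r"
    by auto
qed

lemma norm_sums_unit_unique:
  assumes x: "x \<in> space" and a: "norm_sums sup_norm (\<lambda>n. a n *\<^sub>R unit n) x"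
  shows "a = x"
proof
  fix k
  have partial: "(\<Sum>i<n. a i *\<^sub>R unit i) \<in> space" for n
    by (intro subspace_sum[OF subspace_space] subspace_scale[OF subspace_space] unit_in_space)
  have "(\<lambda>n. (\<Sum>i<n. a i *\<^sub>R unit i) k) \<longlonglongrightarrow> x k"
    using a unfolding norm_sums_def
    by (intro norm_tendsto_coordinate diff_in_space partial x)
  moreover have "(\<lambda>n. (\<Sum>i<n. a i *\<^sub>R unit i) k) \<longlonglongrightarrow> a k"
    unfolding sum_unit by (intro tendsto_eventually eventually_sequentiallyI[of "Suc k"]) simp
  ultimately show "a k = x k"
    by (rule LIMSEQ_unique[rotated])
qed

lemma schauder_basis: "schauder_basis_on space sup_norm unit"
  unfolding schauder_basis_on_def
  using unit_in_space norm_sums_unit norm_sums_unit_unique by blast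

lemma one_unconditional: "one_unconditional_on space sup_norm unit"
  unfolding one_unconditional_on_def
proof (intro allI impI)
  fix a x and \<theta> :: "nat \<Rightarrow> real"
  assume *: "x \<in> space \<and> norm_sums sup_norm (\<lambda>n. a n *\<^sub>R unit n) x \<and> (\<forall>n. \<theta> n \<in> {-1, 1})"
  then have a: "a = x" and x: "x \<in> space"
    using norm_sums_unit_unique by blast+
  define y where "y = (\<lambda>n. \<theta> n * a n)"
  have y: "\<bar>y k\<bar> = \<bar>x k\<bar>" for k
  proof -
    have "\<theta> k = -1 \<or> \<theta> k = 1"
      using * by blast
    then show ?thesis
      by (auto simp: y_def a)
  qed
  then have "y \<in> space"
    using space_solid[OF x] by simp
  moreover have "sup_norm y = sup_norm x"
    using y norm_solid[OF x, of y] norm_solid[OF \<open>y \<in> space\<close>, of x] by simp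
  ultimately show "\<exists>y\<in>space. norm_sums sup_norm (\<lambda>n. (\<theta> n * a n) *\<^sub>R unit n) y \<and> sup_norm y = sup_norm x"
    using norm_sums_unit[of y] unfolding y_def by blast
qed

end

section \<open>Banach--Mazur distance from two-sided estimates\<close>

text \<open>
  Needed for all isomorphisms: it bounds from below the set whose infimum is the Banach--Mazur distance.
\<close>

lemma operator_norm_nonneg:
  assumes X: "0 \<in> X" "N 0 = 0" "\<And>x. x \<in> X \<Longrightarrow> 0 \<le> N x"
    and T: "bounded_linear_between X N Y M T" and M: "M 0 = 0"
  shows "0 \<le> operator_norm X N M T"
  unfolding operator_norm_def
proof (rule cSup_upper)
  have "T (0 *\<^sub>R 0) = 0 *\<^sub>R T 0"
    using T X(1) unfolding bounded_linear_between_def by blast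
  then have "M (T 0) = 0"
    using M by simp
  then show "0 \<in> {M (T x) |x. x \<in> X \<and> N x \<le> 1}"
    using X(1,2) by force
next
  obtain K where K: "\<And>x. x \<in> X \<Longrightarrow> M (T x) \<le> K * N x"
    using T unfolding bounded_linear_between_def by blast
  have "M (T x) \<le> \<bar>K\<bar>" if "x \<in> X" "N x \<le> 1" for x
  proof -
    have "K * N x \<le> \<bar>K\<bar> * N x"
      using X(3)[OF that(1)] by (intro mult_right_mono) auto
    also have "\<dots> \<le> \<bar>K\<bar> * 1"
      using that(2) by (intro mult_left_mono) auto
    finally show ?thesis
      using K[OF that(1)] by simp
  qed
  then show "bdd_above {M (T x) |x. x \<in> X \<and> N x \<le> 1}"
    by (auto simp: bdd_above_def)
qed

lemma operator_norm_le:
  assumes X: "0 \<in> X" "N 0 = 0" and C: "0 \<le> C"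
    and T: "\<And>x. x \<in> X \<Longrightarrow> M (T x) \<le> C * N x"
  shows "operator_norm X N M T \<le> C"
  unfolding operator_norm_def
proof (rule cSup_least)
  show "{M (T x) |x. x \<in> X \<and> N x \<le> 1} \<noteq> {}"
    using X by force
next
  fix r
  assume "r \<in> {M (T x) |x. x \<in> X \<and> N x \<le> 1}"
  then obtain x where x: "r = M (T x)" "x \<in> X" "N x \<le> 1"
    by blast
  have "C * N x \<le> C * 1"
    using C x(3) by (intro mult_left_mono) auto
  then show "r \<le> C"
    using T[OF x(2)] x(1) by simp
qed

lemma banach_mazur_dist_le:
  assumes X: "0 \<in> X" "N 0 = 0" "\<And>x. x \<in> X \<Longrightarrow> 0 \<le> N x"
    and Y: "0 \<in> Y" "M 0 = 0" "\<And>y. y \<in> Y \<Longrightarrow> 0 \<le> M y"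
    and T: "isomorphism_between X N Y M T"
    and C: "0 \<le> C" "\<And>x. x \<in> X \<Longrightarrow> M (T x) \<le> C * N x"
    and D: "0 \<le> D" "\<And>y. y \<in> Y \<Longrightarrow> N (inv_into X T y) \<le> D * M y"
  shows "banach_mazur_dist X N Y M \<le> C * D"
proof -
  have nonneg: "0 \<le> operator_norm X N M U" "0 \<le> operator_norm Y M N (inv_into X U)"
    if "isomorphism_between X N Y M U" for U
    using that operator_norm_nonneg[of X N Y M U, OF X _ Y(2)]
      operator_norm_nonneg[of Y M X N "inv_into X U", OF Y _ X(2)]
    unfolding isomorphism_between_def by auto
  have "banach_mazur_dist X N Y M \<le> operator_norm X N M T * operator_norm Y M N (inv_into X T)"
    unfolding banach_mazur_dist_def
  proof (rule cInf_lower)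
    show "bdd_below {operator_norm X N M U * operator_norm Y M N (inv_into X U) |U.
        isomorphism_between X N Y M U}"
      unfolding bdd_below_def using nonneg by (intro exI[of _ 0]) auto
  qed (use T in blast)
  also have "\<dots> \<le> C * D"
    using operator_norm_le[of X N C M T, OF X(1,2) C]
      operator_norm_le[of Y M D N "inv_into X T", OF Y(1,2) D] nonneg[OF T] C(1)
    by (intro mult_mono)
  finally show ?thesis .
qed

section \<open>Branches of a tree of exponents\<close>

text \<open>
  The node of \<open>p\<close> at level \<open>n\<close> is numbered by the level together with the index of the dyadic interval
  containing \<open>p\<close>. Counting the intervals from \<open>1\<close> makes every natural number a node of some
  branch.
\<close>

definition branch :: "real \<Rightarrow> nat \<Rightarrow> nat"
  where "branch p n = prod_encode (n, nat \<lfloor>2 ^ n * (p - 1)\<rfloor>)"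

lemma fst_prod_decode_branch [simp]: "fst (prod_decode (branch p n)) = n"
  by (simp add: branch_def)

lemma branch_eq_close:
  assumes "1 \<le> p" "1 \<le> q" "branch p n = branch q n"
  shows "\<bar>p - q\<bar> \<le> 1 / 2 ^ n"
proof -
  have "0 \<le> \<lfloor>2 ^ n * (p - 1)\<rfloor>" "0 \<le> \<lfloor>2 ^ n * (q - 1)\<rfloor>"
    using assms by simp_all
  then have "\<lfloor>2 ^ n * (p - 1)\<rfloor> = \<lfloor>2 ^ n * (q - 1)\<rfloor>"
    using assms(3) by (simp add: branch_def eq_nat_nat_iff)
  then have "\<bar>2 ^ n * (p - 1) - 2 ^ n * (q - 1)\<bar> \<le> 1"
    by linarith
  also have "2 ^ n * (p - 1) - 2 ^ n * (q - 1) = 2 ^ n * (p - q)"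
    by (simp add: algebra_simps)
  finally have "2 ^ n * \<bar>p - q\<bar> \<le> 1"
    by (simp add: abs_mult)
  then show ?thesis
    by (simp add: field_simps)
qed

lemma branch_covers: "\<exists>p\<ge>1. branch p (fst (prod_decode k)) = k"
proof -
  obtain n j where k: "k = prod_encode (n, j)"
    by (metis prod_decode_inverse surj_pair)
  have "branch (1 + real j / 2 ^ n) n = k"
    by (simp add: branch_def k)
  then show ?thesis
    using k by (intro exI[of _ "1 + real j / 2 ^ n"]) simp
qed

definition branch_norms :: "((nat \<Rightarrow> real) \<Rightarrow> real) set"
  where "branch_norms = {\<lambda>x. fin_lp p {..<m} (\<lambda>n. x (branch p n)) | p m. 1 \<le> p}"

text \<open>
  A branch has just one node per level, so a unit vector contributes at most one term to
  each seminorm; conversely every coordinate lies on a branch, whose seminorm then dominates it.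
\<close>

interpretation tree: solid_seminorms branch_norms
proof
  fix \<phi> c and x y :: "nat \<Rightarrow> real" and s and k :: nat
  assume "\<phi> \<in> branch_norms"
  then obtain p m where \<phi>: "\<phi> = (\<lambda>x. fin_lp p {..<m} (\<lambda>n. x (branch p n)))" and p: "1 \<le> p"
    unfolding branch_norms_def by blast
  show "\<phi> (c *\<^sub>R x) = \<bar>c\<bar> * \<phi> x"
    by (simp add: \<phi> scaleR_fun_def fin_lp_scale[OF p])
  show "\<phi> (x + y) \<le> \<phi> x + \<phi> y"
    unfolding \<phi> plus_fun_apply by (rule fin_lp_triangle[OF p finite_lessThan])
  show "\<phi> x \<le> \<phi> y" if "\<And>k. \<bar>x k\<bar> \<le> \<bar>y k\<bar>"
    unfolding \<phi> using that by (intro fin_lp_mono[OF p])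
  show "(\<lambda>n. \<phi> (s n)) \<longlonglongrightarrow> \<phi> x" if "\<And>k. (\<lambda>n. s n k) \<longlonglongrightarrow> x k"
    unfolding \<phi> using that by (intro fin_lp_tendsto[OF p])
  have "(\<Sum>n<m. \<bar>unit k (branch p n)\<bar> powr p) \<le> (\<Sum>n<m. if n = fst (prod_decode k) then 1 else 0)"
    using p by (intro sum_mono) (auto simp: unit_def)
  also have "\<dots> \<le> 1"
    by simp
  finally show "\<phi> (unit k) \<le> 1"
    unfolding \<phi> fin_lp_def using p by (subst powr_le_iff_le_powr_inverse) (auto intro: sum_nonneg)
next
  fix k
  define n where "n = fst (prod_decode k)"
  obtain p where p: "1 \<le> p" "branch p n = k"
    using branch_covers[of k] unfolding n_def by blast
  have "\<bar>x k\<bar> \<le> fin_lp p {..<Suc n} (\<lambda>i. x (branch p i))" for x :: "nat \<Rightarrow> real"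
  proof -
    have "\<bar>x k\<bar> = (\<bar>x k\<bar> powr p) powr (1 / p)"
      using p(1) by (simp add: powr_powr)
    also have "\<dots> \<le> fin_lp p {..<Suc n} (\<lambda>i. x (branch p i))"
      unfolding fin_lp_def using p
      by (intro powr_mono2 order_trans[OF _ member_le_sum[of n]]) auto
    finally show ?thesis .
  qed
  moreover have "(\<lambda>x. fin_lp p {..<Suc n} (\<lambda>i. x (branch p i))) \<in> branch_norms"
    using p(1) unfolding branch_norms_def by blast
  ultimately show "\<exists>\<phi>\<in>branch_norms. \<forall>x. \<bar>x k\<bar> \<le> \<phi> x"
    by (intro bexI[of _ "\<lambda>x. fin_lp p {..<Suc n} (\<lambda>i. x (branch p i))"] allI)
qed

section \<open>Sequences placed on the lower part of a branch\<close>

lemma lp_norm_nonneg: "0 \<le> lp_norm p x"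
  by (simp add: lp_norm_def)

lemma fin_lp_le_lp_norm:
  assumes "1 \<le> p" "x \<in> lp_space p" "finite A"
  shows "fin_lp p A x \<le> lp_norm p x"
  unfolding fin_lp_def lp_norm_def using assms
  by (intro powr_mono2 sum_le_suminf sum_nonneg) (auto simp: lp_space_def)

text \<open>
  A sequence is in \<open>\<ell>\<^sup>p\<close> as soon as the norms of its initial segments are bounded. This gives
  membership in \<open>\<ell>\<^sup>p\<close> from the norm of the tree space, which only sees finite pieces.
\<close>

lemma lp_norm_leI:
  assumes p: "1 \<le> p" and bound: "\<And>m. fin_lp p {..<m} x \<le> B"
  shows "x \<in> lp_space p" "lp_norm p x \<le> B"
proof -
  have B: "0 \<le> B"
    using order_trans[OF fin_lp_nonneg bound] .
  have sums: "(\<Sum>i<m. \<bar>x i\<bar> powr p) \<le> B powr p" for m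
    using bound[of m] p B unfolding fin_lp_def
    by (subst (asm) powr_le_iff_le_powr_inverse) (auto intro: sum_nonneg)
  then have summable: "summable (\<lambda>i. \<bar>x i\<bar> powr p)"
    by (intro summableI_nonneg_bounded) auto
  then show "x \<in> lp_space p"
    by (simp add: lp_space_def)
  have "(\<Sum>i. \<bar>x i\<bar> powr p) \<le> B powr p"
    by (rule suminf_le_const[OF summable sums])
  then show "lp_norm p x \<le> B"
    unfolding lp_norm_def using p B summable
    by (subst powr_le_iff_le_powr_inverse) (auto intro: suminf_nonneg)
qed

lemma lp_norm_tail_small:
  assumes p: "1 \<le> p" and x: "x \<in> lp_space p" and e: "0 < e"
  shows "\<exists>j. tail j x \<in> lp_space p \<and> lp_norm p (tail j x) \<le> e"
proof -
  let ?f = "\<lambda>n. \<bar>x n\<bar> powr p"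
  have f: "summable ?f"
    using x by (simp add: lp_space_def)
  obtain j where j: "norm (\<Sum>i. ?f (i + j)) < e powr p"
    using suminf_exist_split[OF _ f, of "e powr p"] e by auto
  let ?g = "\<lambda>n. \<bar>tail j x n\<bar> powr p"
  have g: "summable ?g"
    by (rule summable_comparison_test'[OF f, of 0]) (auto simp: tail_def)
  have "(\<Sum>n. ?g n) = (\<Sum>n. ?g (n + j)) + (\<Sum>n<j. ?g n)"
    by (rule suminf_split_initial_segment[OF g])
  also have "\<dots> = (\<Sum>n. ?f (n + j))"
    by (simp add: tail_def)
  finally have "(\<Sum>n. ?g n) \<le> e powr p"
    using j by simp
  then have "lp_norm p (tail j x) \<le> e"
    unfolding lp_norm_def using p e g
    by (subst powr_le_iff_le_powr_inverse) (auto intro: suminf_nonneg)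
  then show ?thesis
    using g by (auto simp: lp_space_def)
qed

text \<open>
  \<open>place p m\<close> puts a sequence on the branch of \<open>p\<close>, starting at level \<open>m\<close>, and \<open>pick p m\<close> reads it
  off again; the level of the node \<open>k\<close> is the first component of its code.
\<close>

definition place :: "real \<Rightarrow> nat \<Rightarrow> (nat \<Rightarrow> real) \<Rightarrow> nat \<Rightarrow> real"
  where "place p m x k =
    (let n = fst (prod_decode k) in if m \<le> n \<and> branch p n = k then x (n - m) else 0)"

definition pick :: "real \<Rightarrow> nat \<Rightarrow> (nat \<Rightarrow> real) \<Rightarrow> nat \<Rightarrow> real"
  where "pick p m z i = z (branch p (m + i))"

lemma place_branch:
  "place p m x (branch q n) = (if m \<le> n \<and> branch p n = branch q n then x (n - m) else 0)"
  by (simp add: place_def)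

lemma pick_place: "pick p m (place p m x) = x"
  by (auto simp: pick_def place_branch)

lemma place_outside: "k \<notin> branch p ` {m..} \<Longrightarrow> place p m x k = 0"
  unfolding place_def Let_def image_iff by (metis atLeast_iff)

lemma place_pick:
  assumes "\<And>k. k \<notin> branch p ` {m..} \<Longrightarrow> z k = 0"
  shows "place p m (pick p m z) = z"
proof
  fix k
  show "place p m (pick p m z) k = z k"
  proof (cases "k \<in> branch p ` {m..}")
    case True
    then show ?thesis
      by (auto simp: place_branch pick_def)
  qed (simp add: assms place_outside)
qed

text \<open>
  The key estimate. If the branch of \<open>q\<close> shares nodes with the relevant part of the branch of \<open>p\<close>, the
  largest shared level \<open>n\<close> controls both the number of shared nodes (at most \<open>Suc n\<close>) and the
  distance of the exponents (at most \<open>1 / 2 ^ n\<close>).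
\<close>

lemma place_bound:
  assumes p: "1 \<le> p" and \<delta>: "\<forall>n\<ge>m. real (Suc n) / 2 ^ n \<le> \<delta>"
    and x: "x \<in> lp_space p" and \<phi>: "\<phi> \<in> branch_norms"
  shows "\<phi> (place p m x) \<le> (1 + \<delta>) * lp_norm p x"
proof -
  obtain q l where \<phi>: "\<phi> = (\<lambda>x. fin_lp q {..<l} (\<lambda>n. x (branch q n)))" and q: "1 \<le> q"
    using \<phi> unfolding branch_norms_def by blast
  have \<delta>0: "0 \<le> \<delta>"
    using \<delta>[rule_format, OF order_refl] by (rule order_trans[rotated]) simp
  define S where "S = {n. n < l \<and> m \<le> n \<and> branch p n = branch q n}"
  have fin: "finite S"
    by (simp add: S_def)
  have "(\<Sum>n<l. \<bar>place p m x (branch q n)\<bar> powr q) = (\<Sum>n\<in>S. \<bar>x (n - m)\<bar> powr q)"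
    by (rule sum.mono_neutral_cong_right) (auto simp: S_def place_branch)
  then have restrict: "\<phi> (place p m x) = fin_lp q S (\<lambda>n. x (n - m))"
    by (simp add: \<phi> fin_lp_def)
  \<comment> \<open>an empty \<open>S\<close> has no largest level, but then \<open>card S\<close> is zero\<close>
  have small: "card S * \<bar>p - q\<bar> \<le> \<delta>"
  proof (cases "S = {}")
    case False
    define n where "n = Max S"
    have "n \<in> S"
      unfolding n_def using fin False by (rule Max_in)
    then have n: "m \<le> n" "\<bar>p - q\<bar> \<le> 1 / 2 ^ n"
      using branch_eq_close[OF p q] by (auto simp: S_def)
    have "S \<subseteq> {..n}"
      unfolding n_def using fin by auto
    then have "card S \<le> Suc n"
      using card_mono[of "{..n}" S] by simp
    then have "card S * \<bar>p - q\<bar> \<le> Suc n * (1 / 2 ^ n)"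
      using n(2) by (intro mult_mono) (simp_all del: of_nat_Suc)
    then show ?thesis
      using \<delta>[rule_format, OF n(1)] by simp
  qed (simp add: \<delta>0)
  have "inj_on (\<lambda>n. n - m) S"
    by (auto simp: S_def inj_on_def)
  then have "fin_lp p S (\<lambda>n. x (n - m)) = fin_lp p ((\<lambda>n. n - m) ` S) x"
    by (simp add: fin_lp_def sum.reindex)
  also have "\<dots> \<le> lp_norm p x"
    using fin by (intro fin_lp_le_lp_norm p x) simp
  finally have "(1 + card S * \<bar>p - q\<bar>) * fin_lp p S (\<lambda>n. x (n - m)) \<le> (1 + \<delta>) * lp_norm p x"
    using small \<delta>0 by (intro mult_mono) auto
  then show ?thesis
    using fin_lp_change_exponent[OF p q fin, of "\<lambda>n. x (n - m)"] restrict by linarith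
qed

text \<open>
  The codes of the nodes need not increase along a branch, but only finitely many levels have codes below
  a given bound. Hence a late tail of the placed sequence is dominated by the placement of a late
  tail of \<open>x\<close>, which has small norm.
\<close>

lemma place_in_space:
  assumes p: "1 \<le> p" and \<delta>: "\<forall>n\<ge>m. real (Suc n) / 2 ^ n \<le> \<delta>"
    and x: "x \<in> lp_space p"
  shows "place p m x \<in> tree.space"
  unfolding tree.space_def mem_Collect_eq
proof (intro allI impI)
  fix e :: real
  assume e: "0 < e"
  have \<delta>0: "0 \<le> \<delta>"
    using \<delta>[rule_format, OF order_refl] by (rule order_trans[rotated]) simp
  then obtain j where j: "tail j x \<in> lp_space p" "lp_norm p (tail j x) \<le> e / (1 + \<delta>)"
    using lp_norm_tail_small[OF p x, of "e / (1 + \<delta>)"] e by auto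
  \<comment> \<open>any number above the codes of the first \<open>m + j\<close> nodes of the branch\<close>
  define l where "l = Suc (\<Sum>n<m + j. branch p n)"
  have late: "m + j \<le> n" if "l \<le> branch p n" for n
  proof (rule ccontr)
    assume "\<not> m + j \<le> n"
    then have "branch p n \<le> (\<Sum>n<m + j. branch p n)"
      by (intro member_le_sum) auto
    then show False
      using that by (simp add: l_def)
  qed
  have "\<bar>tail l (place p m x) k\<bar> \<le> \<bar>place p m (tail j x) k\<bar>" for k
  proof (cases "k \<in> branch p ` {m..}")
    case True
    then show ?thesis
      using late by (force simp: tail_def place_branch)
  qed (simp add: tail_def place_outside)
  then have "\<phi> (tail l (place p m x)) \<le> e" if "\<phi> \<in> branch_norms" for \<phi>
  proof -
    have "\<phi> (tail l (place p m x)) \<le> \<phi> (place p m (tail j x))"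
      by (rule tree.solid[OF that]) fact
    also have "\<dots> \<le> (1 + \<delta>) * lp_norm p (tail j x)"
      by (rule place_bound[OF p \<delta> j(1) that])
    also have "\<dots> \<le> (1 + \<delta>) * (e / (1 + \<delta>))"
      using j(2) \<delta>0 by (intro mult_left_mono) auto
    finally show ?thesis
      using \<delta>0 by simp
  qed
  then show "\<exists>n. \<forall>\<phi>\<in>branch_norms. \<phi> (tail n (place p m x)) \<le> e"
    by blast
qed

text \<open>
  The branch of \<open>p\<close> itself is one of the branches in the supremum; this is the lower estimate for the
  embedding, with constant \<open>1\<close>.
\<close>

lemma pick_bound:
  assumes p: "1 \<le> p" and z: "z \<in> tree.space"
  shows "pick p m z \<in> lp_space p" "lp_norm p (pick p m z) \<le> tree.sup_norm z"
proof -
  have "fin_lp p {..<l} (pick p m z) \<le> tree.sup_norm z" for l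
  proof -
    have "(\<Sum>i<l. \<bar>pick p m z i\<bar> powr p) = (\<Sum>n\<in>(+) m ` {..<l}. \<bar>z (branch p n)\<bar> powr p)"
      by (subst sum.reindex) (simp_all add: pick_def)
    also have "\<dots> \<le> (\<Sum>n<m + l. \<bar>z (branch p n)\<bar> powr p)"
      by (rule sum_mono2) auto
    finally have "fin_lp p {..<l} (pick p m z) \<le> fin_lp p {..<m + l} (\<lambda>n. z (branch p n))"
      unfolding fin_lp_def using p by (intro powr_mono2) (auto intro: sum_nonneg)
    also have "(\<lambda>x. fin_lp p {..<m + l} (\<lambda>n. x (branch p n))) \<in> branch_norms"
      using p unfolding branch_norms_def by blast
    from tree.le_norm[OF z this] have "fin_lp p {..<m + l} (\<lambda>n. z (branch p n)) \<le> tree.sup_norm z" .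
    finally show ?thesis .
  qed
  then show "pick p m z \<in> lp_space p" "lp_norm p (pick p m z) \<le> tree.sup_norm z"
    using lp_norm_leI[OF p] by blast+
qed

lemma place_isomorphism:
  assumes p: "1 \<le> p" and \<delta>: "\<forall>n\<ge>m. real (Suc n) / 2 ^ n \<le> \<delta>"
  defines "Y \<equiv> {z \<in> tree.space. \<forall>k. k \<notin> branch p ` {m..} \<longrightarrow> z k = 0}"
  shows "isomorphism_between (lp_space p) (lp_norm p) Y tree.sup_norm (place p m)"
    and "\<And>z. z \<in> Y \<Longrightarrow> inv_into (lp_space p) (place p m) z = pick p m z"
    and "\<And>x. x \<in> lp_space p \<Longrightarrow> tree.sup_norm (place p m x) \<le> (1 + \<delta>) * lp_norm p x"
proof -
  have place: "place p m x \<in> Y" if "x \<in> lp_space p" for x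
    using place_in_space[OF p \<delta> that] by (auto simp: Y_def place_outside)
  have pick: "pick p m z \<in> lp_space p" "place p m (pick p m z) = z" if "z \<in> Y" for z
    using that pick_bound(1)[OF p] by (auto simp: Y_def intro!: place_pick)
  have bij: "bij_betw (place p m) (lp_space p) Y"
    by (rule bij_betw_byWitness[where f' = "pick p m"]) (auto simp: place pick pick_place)
  show inv: "inv_into (lp_space p) (place p m) z = pick p m z" if "z \<in> Y" for z
    using bij pick[OF that] by (auto simp: bij_betw_def intro!: inv_into_f_eq)
  show bound: "tree.sup_norm (place p m x) \<le> (1 + \<delta>) * lp_norm p x" if "x \<in> lp_space p" for x
    by (rule tree.norm_le) (rule place_bound[OF p \<delta> that])
  have Y: "subspace Y"
    using tree.subspace_space by (auto simp: Y_def subspace_def scaleR_fun_def)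
  have "bounded_linear_between (lp_space p) (lp_norm p) Y tree.sup_norm (place p m)"
    unfolding bounded_linear_between_def
    using place bound by (auto simp: place_def Let_def fun_eq_iff scaleR_fun_def)
  moreover have "bounded_linear_between Y tree.sup_norm (lp_space p) (lp_norm p)
      (inv_into (lp_space p) (place p m))"
    unfolding bounded_linear_between_def
  proof (intro conjI ballI allI)
    show "inv_into (lp_space p) (place p m) ` Y \<subseteq> lp_space p"
      using inv pick by auto
    show "\<exists>K. \<forall>z\<in>Y. lp_norm p (inv_into (lp_space p) (place p m) z) \<le> K * tree.sup_norm z"
      using pick_bound(2)[OF p] by (intro exI[of _ 1]) (auto simp: inv, simp add: Y_def)
    fix x assume x: "x \<in> Y"
    show "inv_into (lp_space p) (place p m) (x + y)
        = inv_into (lp_space p) (place p m) x + inv_into (lp_space p) (place p m) y"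
      if "y \<in> Y" for y
      using x that subspace_add[OF Y x that] by (simp add: inv pick_def fun_eq_iff)
    show "inv_into (lp_space p) (place p m) (c *\<^sub>R x)
        = c *\<^sub>R inv_into (lp_space p) (place p m) x" for c
      unfolding inv[OF x] inv[OF subspace_scale[OF Y x]]
      by (simp add: pick_def fun_eq_iff scaleR_fun_def)
  qed
  ultimately show "isomorphism_between (lp_space p) (lp_norm p) Y tree.sup_norm (place p m)"
    using bij by (simp add: isomorphism_between_def)
qed

lemma Suc_over_power2_eventually_le:
  fixes \<delta> :: real
  assumes "0 < \<delta>"
  obtains m where "\<forall>n\<ge>m. real (Suc n) / 2 ^ n \<le> \<delta>"
proof -
  have shift: "2 * (real (Suc n) / 2 ^ Suc n) = real (Suc n) / 2 ^ n" for n
    by (simp del: of_nat_Suc)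
  have "(\<lambda>n. 2 * (real (Suc n) / 2 ^ Suc n)) \<longlonglongrightarrow> 2 * 0"
    by (intro tendsto_mult tendsto_const LIMSEQ_Suc[OF lim_n_over_pown]) simp
  then have "\<forall>\<^sub>F n in sequentially. real (Suc n) / 2 ^ n < \<delta>"
    unfolding shift using assms by (intro order_tendstoD(2)) auto
  then show thesis
    using that unfolding eventually_sequentially by (meson less_imp_le)
qed

lemma lp_almost_isometrically_in_tree:
  assumes p: "1 \<le> p" and \<epsilon>: "0 < \<epsilon>"
  shows "\<exists>Y\<subseteq>tree.space. banach_space_on Y tree.sup_norm \<and>
    isomorphic_spaces (lp_space p) (lp_norm p) Y tree.sup_norm \<and>
    banach_mazur_dist (lp_space p) (lp_norm p) Y tree.sup_norm < 1 + \<epsilon>"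
proof -
  obtain m where m: "\<forall>n\<ge>m. real (Suc n) / 2 ^ n \<le> \<epsilon> / 2"
    using Suc_over_power2_eventually_le half_gt_zero[OF \<epsilon>] by blast
  define Y where "Y = {z \<in> tree.space. \<forall>k. k \<notin> branch p ` {m..} \<longrightarrow> z k = 0}"
  note iso = place_isomorphism[OF p m, folded Y_def]
  have banach: "banach_space_on Y tree.sup_norm"
    unfolding Y_def by (rule tree.banach_subspace)
  then have normed: "normed_space_on Y tree.sup_norm"
    by (simp add: banach_space_on_def)
  have Y0: "0 \<in> Y"
    using normed by (simp add: normed_space_on_def subspace_0)
  have "banach_mazur_dist (lp_space p) (lp_norm p) Y tree.sup_norm \<le> (1 + \<epsilon> / 2) * 1"
  proof (rule banach_mazur_dist_le[where T = "place p m"])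
    show "0 \<le> lp_norm p x" for x
      by (rule lp_norm_nonneg)
    show "0 \<in> lp_space p" "lp_norm p 0 = 0"
      by (simp_all add: lp_space_def lp_norm_def)
    show "tree.sup_norm 0 = 0" "\<And>z. z \<in> Y \<Longrightarrow> 0 \<le> tree.sup_norm z"
      using normed Y0 by (auto simp: normed_space_on_def)
    show "lp_norm p (inv_into (lp_space p) (place p m) z) \<le> 1 * tree.sup_norm z" if "z \<in> Y" for z
      using that pick_bound(2)[OF p] by (simp add: iso(2)) (simp add: Y_def)
  qed (use \<epsilon> Y0 iso(1,3) in auto)
  then show ?thesis
    using banach iso(1) \<epsilon> by (intro exI[of _ Y]) (auto simp: Y_def isomorphic_spaces_def)
qed

theorem theorem1p1:
  shows "\<exists>(Z :: (nat \<Rightarrow> real) set) N.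
    banach_space_on Z N \<and>
    (\<exists>f. schauder_basis_on Z N f \<and> one_unconditional_on Z N f) \<and>
    (\<forall>p::real. 1 \<le> p \<longrightarrow>
      contained_almost_isometrically (lp_space p) (lp_norm p) Z N \<and>
      contains_isomorphic_copy Z N (lp_space p) (lp_norm p))"
proof (intro exI conjI allI impI)
  show "banach_space_on tree.space tree.sup_norm"
    using tree.banach_subspace[of UNIV] by simp
  show "schauder_basis_on tree.space tree.sup_norm unit"
    by (rule tree.schauder_basis)
  show "one_unconditional_on tree.space tree.sup_norm unit"
    by (rule tree.one_unconditional)
next
  fix p :: real
  assume p: "1 \<le> p"
  show "contained_almost_isometrically (lp_space p) (lp_norm p) tree.space tree.sup_norm"
    unfolding contained_almost_isometrically_def using lp_almost_isometrically_in_tree[OF p] by blast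
  show "contains_isomorphic_copy tree.space tree.sup_norm (lp_space p) (lp_norm p)"
    unfolding contains_isomorphic_copy_def
    using lp_almost_isometrically_in_tree[OF p zero_less_one] by blast
qed

end
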